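(* Let $k$ be a field with $\mathrm{char}(k)\neq 2$. Every $3$-cocycle on $C_2\times C_2$ with coefficients in $k^*$ is cohomologous to a happy normalized $3$-cocycle.
   Context: $C_2\times C_2=\{e,\sigma,\tau,\rho\}$ is the Klein group, with $\sigma\tau=\tau\sigma=\rho$, $\sigma^2=\tau^2=e$. $k^*=k\setminus\{0\}$. A $3$-cocycle on a group $G$ (coefficients in $k^*$, trivial action) is a map $\phi:G^3\to k^*$ with $\phi(y,z,t)\phi(x,yz,t)\phi(x,y,z)=\phi(xy,z,t)\phi(x,y,zt)$ for all $x,y,z,t\in G$. For $g:G^2\to k^*$, $\Delta_2(g)(x,y,z)=g(y,z)g(xy,z)^{-1}g(x,yz)g(x,y)^{-1}$; the maps $\Delta_2(g)$ are the $3$-coboundaries. Two $3$-cocycles are cohomologous if their pointwise quotient is a $3$-coboundary. A $3$-cocycle is normalized if $\phi(x,e,z)=1$ for all $x,z\in G$. For a normalized $3$-cocycle $\phi$ on $C_2\times C_2$ put $p=\phi(\sigma,\tau,\rho)\phi(\tau,\rho,\sigma)\phi(\rho,\sigma,\tau)$. $\phi$ is called happy if $\phi(x,y,z)=p$ whenever $x,y,z$ are pairwise distinct elements of $\{\sigma,\tau,\rho\}$. *)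

theory Defs
  imports "HOL-Computational_Algebra.Computational_Algebra"
    "HOL-Library.Numeral_Type" "HOL-Library.Product_Plus"
begin

text \<open>Groups are types of class \<^class>\<open>group_add\<close>, hence written additively:
  \<open>x + y\<close> is the product \<open>xy\<close> and \<open>0\<close> is the neutral element \<open>e\<close>. The coefficients are
  the nonzero elements of a field and are written multiplicatively.\<close>

definition cocycle3 :: "('g::group_add \<Rightarrow> 'g \<Rightarrow> 'g \<Rightarrow> 'k::field) \<Rightarrow> bool" where
  "cocycle3 \<phi> \<longleftrightarrow>
     (\<forall>x y z. \<phi> x y z \<noteq> 0) \<and>
     (\<forall>x y z t. \<phi> y z t * \<phi> x (y + z) t * \<phi> x y z = \<phi> (x + y) z t * \<phi> x y (z + t))"

definition \<Delta>\<^sub>2 :: "('g::group_add \<Rightarrow> 'g \<Rightarrow> 'k::field) \<Rightarrow> 'g \<Rightarrow> 'g \<Rightarrow> 'g \<Rightarrow> 'k" where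
  "\<Delta>\<^sub>2 g x y z = g y z * inverse (g (x + y) z) * g x (y + z) * inverse (g x y)"

definition coboundary3 :: "('g::group_add \<Rightarrow> 'g \<Rightarrow> 'g \<Rightarrow> 'k::field) \<Rightarrow> bool" where
  "coboundary3 f \<longleftrightarrow> (\<exists>g. (\<forall>x y. g x y \<noteq> 0) \<and> f = \<Delta>\<^sub>2 g)"

definition cohomologous3 ::
  "('g::group_add \<Rightarrow> 'g \<Rightarrow> 'g \<Rightarrow> 'k::field) \<Rightarrow> ('g \<Rightarrow> 'g \<Rightarrow> 'g \<Rightarrow> 'k) \<Rightarrow> bool" where
  "cohomologous3 \<phi> \<psi> \<longleftrightarrow>
     cocycle3 \<phi> \<and> cocycle3 \<psi> \<and> coboundary3 (\<lambda>x y z. \<phi> x y z / \<psi> x y z)"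

definition normalized_cocycle3 :: "('g::group_add \<Rightarrow> 'g \<Rightarrow> 'g \<Rightarrow> 'k::field) \<Rightarrow> bool" where
  "normalized_cocycle3 \<phi> \<longleftrightarrow> cocycle3 \<phi> \<and> (\<forall>x z. \<phi> x 0 z = 1)"

text \<open>The Klein group as \<open>\<int>/2 \<times> \<int>/2\<close>, with componentwise addition.\<close>

type_synonym klein = "2 \<times> 2"

definition \<sigma> :: klein where "\<sigma> = (1, 0)"
definition \<tau> :: klein where "\<tau> = (0, 1)"
definition \<rho> :: klein where "\<rho> = (1, 1)"

lemma klein_add:
  "\<sigma> + \<sigma> = 0" "\<tau> + \<tau> = 0" "\<sigma> + \<tau> = \<rho>" "\<tau> + \<sigma> = \<rho>"
  by (simp_all add: \<sigma>_def \<tau>_def \<rho>_def zero_prod_def)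

lemma klein_distinct: "distinct [0, \<sigma>, \<tau>, \<rho>]"
  by (simp add: \<sigma>_def \<tau>_def \<rho>_def zero_prod_def)

lemma klein_UNIV: "(UNIV :: klein set) = {0, \<sigma>, \<tau>, \<rho>}"
proof (rule sym, rule card_subset_eq)
  show "card {0, \<sigma>, \<tau>, \<rho>} = card (UNIV :: klein set)"
    using klein_distinct by simp
qed simp_all

definition happy :: "(klein \<Rightarrow> klein \<Rightarrow> klein \<Rightarrow> 'k::field) \<Rightarrow> bool" where
  "happy \<phi> \<longleftrightarrow>
     (\<forall>x\<in>{\<sigma>, \<tau>, \<rho>}. \<forall>y\<in>{\<sigma>, \<tau>, \<rho>}. \<forall>z\<in>{\<sigma>, \<tau>, \<rho>}.
        x \<noteq> y \<and> y \<noteq> z \<and> x \<noteq> z \<longrightarrow>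
        \<phi> x y z = \<phi> \<sigma> \<tau> \<rho> * \<phi> \<tau> \<rho> \<sigma> * \<phi> \<rho> \<sigma> \<tau>)"

end

theory Submission
  imports Defs
begin

text \<open>Dividing a cocycle \<open>\<phi>\<close> by \<open>\<Delta>\<^sub>2 g\<close> does not change its class. The relation at \<open>(x, e, e, t)\<close>
  says \<open>\<phi>(x,e,t) = \<phi>(e,e,t) \<phi>(x,e,e)\<close>, and \<open>\<Delta>\<^sub>2 g (x,e,t) = g(e,t) / g(x,e)\<close>; so values of \<open>g\<close> on
  the two axes can be chosen that make the quotient normalized.

  Now let \<open>\<phi>\<close> be normalized on the Klein group, and let \<open>p\<close> and \<open>q\<close> be the products of \<open>\<phi>\<close> over
  the cyclic rotations of \<open>(\<sigma>,\<tau>,\<rho>)\<close> and of \<open>(\<tau>,\<sigma>,\<rho>)\<close>. If \<open>g\<close> is trivial on the axes and on the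
  diagonal, then on a triple of distinct involutions \<open>\<Delta>\<^sub>2 g (x,y,z) = g(y,z) / g(x,y)\<close>. In each of
  the two cyclic families, the successive quotients of three free values of \<open>g\<close> can be anything
  with product \<open>1\<close>. Hence \<open>\<phi>\<close> can be changed so that all six values equal \<open>p\<close> as soon as
  \<open>p = p\<^sup>3\<close> and \<open>q = p\<^sup>3\<close>.

  The heart of the matter is therefore that \<open>p = q\<close> (\<open>cyclic_product_reverse\<close>) and \<open>p q = 1\<close>
  (\<open>cyclic_product_mult_reverse\<close>). Both follow by multiplying suitable families of
  cocycle relations, in which all the factors \<open>\<phi>(x,y,z)\<close> with a repeated entry cancel.\<close>

section \<open>Changing a cocycle by a coboundary\<close>

lemma cocycle3_nonzero: "cocycle3 \<phi> \<Longrightarrow> \<phi> x y z \<noteq> 0"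
  by (simp add: cocycle3_def)

lemma cocycle3_relation:
  "cocycle3 \<phi> \<Longrightarrow> \<phi> y z t * \<phi> x (y + z) t * \<phi> x y z = \<phi> (x + y) z t * \<phi> x y (z + t)"
  by (simp add: cocycle3_def)

lemma \<Delta>\<^sub>2_nonzero: "(\<And>x y. g x y \<noteq> 0) \<Longrightarrow> \<Delta>\<^sub>2 g x y z \<noteq> 0"
  by (simp add: \<Delta>\<^sub>2_def)

lemma cocycle3_\<Delta>\<^sub>2:
  fixes g :: "'g::group_add \<Rightarrow> 'g \<Rightarrow> 'k::field"
  assumes "\<And>x y. g x y \<noteq> 0"
  shows "cocycle3 (\<Delta>\<^sub>2 g)"
proof -
  have "\<Delta>\<^sub>2 g y z t * \<Delta>\<^sub>2 g x (y + z) t * \<Delta>\<^sub>2 g x y z = \<Delta>\<^sub>2 g (x + y) z t * \<Delta>\<^sub>2 g x y (z + t)" for x y z t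
  proof -
    have cancel: "(a * inverse b * c * inverse d) * (b * u * v * inverse e) * (d * w * e * s)
        = (a * u * f * w) * (c * inverse f * v * s)"
      if "b \<noteq> 0" "d \<noteq> 0" "e \<noteq> 0" "f \<noteq> 0" for a b c d e f s u v w :: 'k
      using that by (simp add: field_simps)
    show ?thesis
      unfolding \<Delta>\<^sub>2_def add.assoc by (rule cancel) (rule assms)+
  qed
  then show ?thesis
    using \<Delta>\<^sub>2_nonzero[of g, OF assms] unfolding cocycle3_def by blast
qed

lemma cocycle3_divide:
  assumes "cocycle3 \<phi>" "cocycle3 \<psi>"
  shows "cocycle3 (\<lambda>x y z. \<phi> x y z / \<psi> x y z)"
  unfolding cocycle3_def times_divide_times_eq
    cocycle3_relation[OF assms(1)] cocycle3_relation[OF assms(2)]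
  using assms by (simp add: cocycle3_nonzero)

lemma cohomologous3_divide_\<Delta>\<^sub>2:
  assumes "cocycle3 \<phi>" and g: "\<And>x y. g x y \<noteq> 0"
  shows "cohomologous3 \<phi> (\<lambda>x y z. \<phi> x y z / \<Delta>\<^sub>2 g x y z)"
proof -
  have "(\<lambda>x y z. \<phi> x y z / (\<phi> x y z / \<Delta>\<^sub>2 g x y z)) = \<Delta>\<^sub>2 g"
    by (simp add: fun_eq_iff cocycle3_nonzero[OF assms(1)])
  then show ?thesis
    unfolding cohomologous3_def coboundary3_def
    using assms cocycle3_divide[OF assms(1) cocycle3_\<Delta>\<^sub>2[of g, OF g]] by auto
qed

lemma cohomologous3_trans:
  assumes "cohomologous3 \<phi> \<psi>" "cohomologous3 \<psi> \<chi>"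
  shows "cohomologous3 \<phi> \<chi>"
proof -
  obtain g h where g: "\<And>x y. g x y \<noteq> 0" "(\<lambda>x y z. \<phi> x y z / \<psi> x y z) = \<Delta>\<^sub>2 g"
    and h: "\<And>x y. h x y \<noteq> 0" "(\<lambda>x y z. \<psi> x y z / \<chi> x y z) = \<Delta>\<^sub>2 h"
    using assms unfolding cohomologous3_def coboundary3_def by auto
  have "\<psi> x y z \<noteq> 0" for x y z
    using assms by (simp add: cohomologous3_def cocycle3_nonzero)
  then have "\<phi> x y z / \<chi> x y z = (\<phi> x y z / \<psi> x y z) * (\<psi> x y z / \<chi> x y z)" for x y z
    by simp
  also have "\<dots> x y z = \<Delta>\<^sub>2 g x y z * \<Delta>\<^sub>2 h x y z" for x y z
    using fun_cong[OF fun_cong[OF fun_cong[OF g(2)]], of x y z]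
      fun_cong[OF fun_cong[OF fun_cong[OF h(2)]], of x y z] by simp
  also have "\<dots> x y z = \<Delta>\<^sub>2 (\<lambda>x y. g x y * h x y) x y z" for x y z
    by (simp add: \<Delta>\<^sub>2_def mult_ac)
  finally have "(\<lambda>x y z. \<phi> x y z / \<chi> x y z) = \<Delta>\<^sub>2 (\<lambda>x y. g x y * h x y)"
    by (simp add: fun_eq_iff)
  moreover have "g x y * h x y \<noteq> 0" for x y
    using g(1) h(1) by simp
  ultimately have "coboundary3 (\<lambda>x y z. \<phi> x y z / \<chi> x y z)"
    unfolding coboundary3_def by (intro exI[of _ "\<lambda>x y. g x y * h x y"]) blast
  then show ?thesis
    using assms by (simp add: cohomologous3_def)
qed

section \<open>Normalization\<close>

lemma cohomologous3_normalized:
  fixes \<phi> :: "'g::group_add \<Rightarrow> 'g \<Rightarrow> 'g \<Rightarrow> 'k::field"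
  assumes \<phi>: "cocycle3 \<phi>"
  shows "\<exists>\<psi>. normalized_cocycle3 \<psi> \<and> cohomologous3 \<phi> \<psi>"
proof -
  note nz = cocycle3_nonzero[OF \<phi>]
  have middle: "\<phi> x 0 t = \<phi> 0 0 t * \<phi> x 0 0" for x t
    using cocycle3_relation[OF \<phi>, of 0 0 t x] nz by simp
  then have one: "\<phi> 0 0 0 = 1"
    using nz by (metis mult_cancel_right1)
  define g where "g x y = (if x = 0 then \<phi> 0 0 y else if y = 0 then inverse (\<phi> x 0 0) else 1)"
    for x y
  have g: "g x y \<noteq> 0" for x y
    using nz by (simp add: g_def)
  have "\<Delta>\<^sub>2 g x 0 z = g 0 z / g x 0" for x z
    using g by (simp add: \<Delta>\<^sub>2_def field_simps)
  \<comment> \<open>The two prescriptions for \<open>g 0 0\<close> agree because \<open>\<phi> 0 0 0 = 1\<close>.\<close>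
  also have "\<dots> x z = \<phi> x 0 z" for x z
    using middle[of x z] one by (simp add: g_def divide_inverse)
  finally have "\<phi> x 0 z / \<Delta>\<^sub>2 g x 0 z = 1" for x z
    using nz by simp
  then have "normalized_cocycle3 (\<lambda>x y z. \<phi> x y z / \<Delta>\<^sub>2 g x y z)"
    using cocycle3_divide[OF \<phi> cocycle3_\<Delta>\<^sub>2[of g, OF g]] by (simp add: normalized_cocycle3_def)
  then show ?thesis
    using cohomologous3_divide_\<Delta>\<^sub>2[of \<phi> g, OF \<phi> g] by blast
qed

text \<open>A normalized cocycle is trivial as soon as any argument, not just the middle one, is neutral.\<close>

lemma normalized_cocycle3_trivial:
  assumes "normalized_cocycle3 \<phi>"
  shows "\<phi> x 0 z = 1" "\<phi> 0 y z = 1" "\<phi> x y 0 = 1"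
proof -
  have \<phi>: "cocycle3 \<phi>" and mid: "\<And>x z. \<phi> x 0 z = 1"
    using assms by (auto simp: normalized_cocycle3_def)
  note nz = cocycle3_nonzero[OF \<phi>]
  show "\<phi> x 0 z = 1" by (rule mid)
  show "\<phi> 0 y z = 1"
    using cocycle3_relation[OF \<phi>, of 0 y z 0] nz by (simp add: mid)
  show "\<phi> x y 0 = 1"
    using cocycle3_relation[OF \<phi>, of y 0 0 x] nz by (simp add: mid)
qed

section \<open>The cyclic products\<close>

lemma commuting_involutions_add:
  fixes x y :: "'g::ab_group_add"
  assumes "x + x = 0" "y + y = 0" "z = x + y"
  shows "x + y = z" "y + x = z" "y + z = x" "z + y = x" "z + x = y" "x + z = y" "z + z = 0"
proof -
  have "x + (x + a) = a" "y + (y + a) = a" for a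
    using assms(1,2) by (simp_all flip: add.assoc)
  then show "x + y = z" "y + x = z" "y + z = x" "z + y = x" "z + x = y" "x + z = y" "z + z = 0"
    using assms by (simp_all add: add_ac)
qed

text \<open>The relation at \<open>(x,y,z,z)\<close> expresses \<open>\<phi> x y z\<close> through values with a repeated entry, and so
  does the relation at \<open>(x,x,y,z)\<close>. Expressing one cyclic product in the first way and the other in the
  second way gives the same result.\<close>

lemma cyclic_product_reverse:
  fixes \<phi> :: "'g::ab_group_add \<Rightarrow> 'g \<Rightarrow> 'g \<Rightarrow> 'k::field"
  assumes \<phi>: "normalized_cocycle3 \<phi>" and xy: "x + x = 0" "y + y = 0" "z = x + y"
  shows "\<phi> x y z * \<phi> y z x * \<phi> z x y = \<phi> y x z * \<phi> x z y * \<phi> z y x"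
proof -
  have coc: "cocycle3 \<phi>" using \<phi> by (simp add: normalized_cocycle3_def)
  note rel = cocycle3_relation[OF coc]
  note simps = normalized_cocycle3_trivial[OF \<phi>] commuting_involutions_add[OF xy] xy(1,2)
  define c where "c = \<phi> y z z * \<phi> z x x * \<phi> x y y * \<phi> x x z * \<phi> y y x * \<phi> z z y"
  have "\<phi> x y z * \<phi> y z x * \<phi> z x y * c =
      (\<phi> y z z * \<phi> x x z * \<phi> x y z) * (\<phi> z x x * \<phi> y y x * \<phi> y z x) *
      (\<phi> x y y * \<phi> z z y * \<phi> z x y)"
    by (simp add: c_def mult_ac)
  also have "\<dots> = \<phi> z z z * \<phi> x x x * \<phi> y y y"
    using rel[of y z z x] rel[of z x x y] rel[of x y y z] by (simp only: simps mult_1_left mult_1_right)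
  also have "\<dots> = (\<phi> z y x * \<phi> z x x * \<phi> z z y) * (\<phi> x z y * \<phi> x y y * \<phi> x x z) *
      (\<phi> y x z * \<phi> y z z * \<phi> y y x)"
    using rel[of z y x z] rel[of x z y x] rel[of y x z y] by (simp only: simps mult_1_left mult_1_right)
  also have "\<dots> = \<phi> y x z * \<phi> x z y * \<phi> z y x * c"
    by (simp add: c_def mult_ac)
  finally show ?thesis
    using cocycle3_nonzero[OF coc] by (simp add: c_def)
qed

text \<open>The relation at \<open>(x,y,x,z)\<close> reads
  \<open>\<phi>(y,x,z) \<phi>(x,z,z) \<phi>(x,y,x) = \<phi>(z,x,z) \<phi>(x,y,y)\<close>. In the product over the six orderings of the
  three involutions, the factors of the shapes \<open>\<phi>(a,b,b)\<close> and \<open>\<phi>(a,b,a)\<close> occur once on either side.\<close>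

lemma cyclic_product_mult_reverse:
  fixes \<phi> :: "'g::ab_group_add \<Rightarrow> 'g \<Rightarrow> 'g \<Rightarrow> 'k::field"
  assumes \<phi>: "normalized_cocycle3 \<phi>" and xy: "x + x = 0" "y + y = 0" "z = x + y"
  shows "(\<phi> x y z * \<phi> y z x * \<phi> z x y) * (\<phi> y x z * \<phi> x z y * \<phi> z y x) = 1"
proof -
  have coc: "cocycle3 \<phi>" using \<phi> by (simp add: normalized_cocycle3_def)
  note rel = cocycle3_relation[OF coc]
  note simps = normalized_cocycle3_trivial[OF \<phi>] commuting_involutions_add[OF xy] xy(1,2)
  define c where "c = (\<phi> x y x * \<phi> y x y * \<phi> x z x * \<phi> z x z * \<phi> y z y * \<phi> z y z) *
     (\<phi> x y y * \<phi> y x x * \<phi> x z z * \<phi> z x x * \<phi> y z z * \<phi> z y y)"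
  have "(\<phi> x y z * \<phi> y z x * \<phi> z x y) * (\<phi> y x z * \<phi> x z y * \<phi> z y x) * c =
      (\<phi> y x z * \<phi> x z z * \<phi> x y x) * (\<phi> x y z * \<phi> y z z * \<phi> y x y) *
      (\<phi> z x y * \<phi> x y y * \<phi> x z x) * (\<phi> x z y * \<phi> z y y * \<phi> z x z) *
      (\<phi> z y x * \<phi> y x x * \<phi> y z y) * (\<phi> y z x * \<phi> z x x * \<phi> z y z)"
    by (simp add: c_def mult_ac)
  also have "\<dots> = (\<phi> z x z * \<phi> x y y) * (\<phi> z y z * \<phi> y x x) * (\<phi> y x y * \<phi> x z z) *
      (\<phi> y z y * \<phi> z x x) * (\<phi> x y x * \<phi> y z z) * (\<phi> x z x * \<phi> z y y)"
    using rel[of y x z x] rel[of x y z y] rel[of z x y x] rel[of x z y z] rel[of z y x y]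
      rel[of y z x z] by (simp only: simps)
  also have "\<dots> = 1 * c"
    by (simp add: c_def mult_ac)
  finally show ?thesis
    using cocycle3_nonzero[OF coc] by (simp add: c_def)
qed

section \<open>Happy representatives\<close>

lemma klein_add_table:
  "\<sigma> + \<sigma> = 0" "\<tau> + \<tau> = 0" "\<rho> + \<rho> = 0" "\<sigma> + \<tau> = \<rho>" "\<tau> + \<sigma> = \<rho>"
  "\<tau> + \<rho> = \<sigma>" "\<rho> + \<tau> = \<sigma>" "\<rho> + \<sigma> = \<tau>" "\<sigma> + \<rho> = \<tau>"
  using klein_add commuting_involutions_add[of \<sigma> \<tau> \<rho>] by auto

lemma normalized_cohomologous3_happy:
  fixes \<phi> :: "klein \<Rightarrow> klein \<Rightarrow> klein \<Rightarrow> 'k::field"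
  assumes \<phi>: "normalized_cocycle3 \<phi>"
  shows "\<exists>\<psi>. normalized_cocycle3 \<psi> \<and> happy \<psi> \<and> cohomologous3 \<phi> \<psi>"
proof -
  have coc: "cocycle3 \<phi>" using \<phi> by (simp add: normalized_cocycle3_def)
  note nz = cocycle3_nonzero[OF coc]
  have distinct: "0 \<noteq> \<sigma>" "0 \<noteq> \<tau>" "0 \<noteq> \<rho>" "\<sigma> \<noteq> \<tau>" "\<sigma> \<noteq> \<rho>" "\<tau> \<noteq> \<rho>"
    using klein_distinct by auto
  define p where "p = \<phi> \<sigma> \<tau> \<rho> * \<phi> \<tau> \<rho> \<sigma> * \<phi> \<rho> \<sigma> \<tau>"
  have p0: "p \<noteq> 0"
    using nz by (simp add: p_def)
  have q: "\<phi> \<tau> \<sigma> \<rho> * \<phi> \<sigma> \<rho> \<tau> * \<phi> \<rho> \<tau> \<sigma> = p"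
    using cyclic_product_reverse[OF \<phi>, of \<sigma> \<tau> \<rho>] by (simp add: p_def klein_add_table)
  have pp: "p * p = 1"
    using cyclic_product_mult_reverse[OF \<phi>, of \<sigma> \<tau> \<rho>] q by (simp add: p_def klein_add_table)
  \<comment> \<open>Start from \<open>g \<sigma> \<tau> = g \<tau> \<sigma> = 1\<close> and solve \<open>g y z / g x y = \<phi> x y z / p\<close> forwards for \<open>g y \<rho>\<close>
    and backwards for \<open>g \<rho> y\<close>.\<close>
  define g where "g a b =
      (if a \<in> {\<sigma>, \<tau>} \<and> b = \<rho> then \<phi> (a + \<rho>) a \<rho> / p
       else if a = \<rho> \<and> b \<in> {\<sigma>, \<tau>} then p / \<phi> \<rho> b (\<rho> + b) else 1)" for a b
  have g: "g a b \<noteq> 0" for a b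
    using nz p0 by (simp add: g_def)
  define \<psi> where "\<psi> x y z = \<phi> x y z / \<Delta>\<^sub>2 g x y z" for x y z
  have coc\<psi>: "cocycle3 \<psi>"
    using cocycle3_divide[OF coc cocycle3_\<Delta>\<^sub>2[of g, OF g]] by (simp add: \<psi>_def[abs_def])
  have "g 0 z = 1" "g x 0 = 1" for x z
    using distinct by (auto simp: g_def)
  then have "\<Delta>\<^sub>2 g x 0 z = 1" for x z
    using g by (simp add: \<Delta>\<^sub>2_def)
  then have norm: "normalized_cocycle3 \<psi>"
    using coc\<psi> normalized_cocycle3_trivial[OF \<phi>] by (simp add: normalized_cocycle3_def \<psi>_def)
  have vals: "g \<sigma> \<tau> = 1" "g \<tau> \<sigma> = 1" "g \<sigma> \<sigma> = 1" "g \<tau> \<tau> = 1" "g \<rho> \<rho> = 1"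
    "g \<tau> \<rho> = \<phi> \<sigma> \<tau> \<rho> / p" "g \<sigma> \<rho> = \<phi> \<tau> \<sigma> \<rho> / p"
    "g \<rho> \<sigma> = p / \<phi> \<rho> \<sigma> \<tau>" "g \<rho> \<tau> = p / \<phi> \<rho> \<tau> \<sigma>"
    using distinct by (auto simp: g_def klein_add_table)
  have "\<psi> \<sigma> \<tau> \<rho> = p" "\<psi> \<rho> \<sigma> \<tau> = p" "\<psi> \<tau> \<sigma> \<rho> = p" "\<psi> \<rho> \<tau> \<sigma> = p"
    using nz p0 by (simp_all add: \<psi>_def \<Delta>\<^sub>2_def vals klein_add_table)
  \<comment> \<open>The two equations not used to choose \<open>g\<close> are the closing conditions \<open>p = p\<^sup>3\<close> and \<open>q = p\<^sup>3\<close>.\<close>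
  moreover have "\<psi> \<tau> \<rho> \<sigma> = p"
  proof -
    have "\<psi> \<tau> \<rho> \<sigma> = (\<phi> \<sigma> \<tau> \<rho> * \<phi> \<tau> \<rho> \<sigma> * \<phi> \<rho> \<sigma> \<tau>) / (p * p)"
      using nz p0 by (simp add: \<psi>_def \<Delta>\<^sub>2_def vals klein_add_table)
    then show ?thesis by (simp add: pp p_def[symmetric])
  qed
  moreover have "\<psi> \<sigma> \<rho> \<tau> = p"
  proof -
    have "\<psi> \<sigma> \<rho> \<tau> = (\<phi> \<tau> \<sigma> \<rho> * \<phi> \<sigma> \<rho> \<tau> * \<phi> \<rho> \<tau> \<sigma>) / (p * p)"
      using nz p0 by (simp add: \<psi>_def \<Delta>\<^sub>2_def vals klein_add_table)
    then show ?thesis by (simp add: pp q)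
  qed
  ultimately have "happy \<psi>"
    using distinct pp by (auto simp: happy_def)
  moreover have "cohomologous3 \<phi> \<psi>"
    using cohomologous3_divide_\<Delta>\<^sub>2[of \<phi> g, OF coc g] by (simp add: \<psi>_def[abs_def])
  ultimately show ?thesis
    using norm by blast
qed

theorem proposition3p3:
  fixes \<phi> :: "klein \<Rightarrow> klein \<Rightarrow> klein \<Rightarrow> 'k::field"
  assumes "CHAR('k) \<noteq> 2"
    and "cocycle3 \<phi>"
  shows "\<exists>\<psi>. normalized_cocycle3 \<psi> \<and> happy \<psi> \<and> cohomologous3 \<phi> \<psi>"
proof -
  obtain \<chi> where "normalized_cocycle3 \<chi>" "cohomologous3 \<phi> \<chi>"
    using cohomologous3_normalized[OF assms(2)] by blast
  moreover obtain \<psi> where "normalized_cocycle3 \<psi>" "happy \<psi>" "cohomologous3 \<chi> \<psi>"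
    using normalized_cohomologous3_happy[OF \<open>normalized_cocycle3 \<chi>\<close>] by blast
  ultimately show ?thesis
    using cohomologous3_trans[of \<phi> \<chi> \<psi>] by blast
qed

end
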